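(* Let $p\geq 2$ be an integer and let $g(m)=\max\{\mathrm{Mad}(G) : e(G)=m\}$. (i) If $m=\binom{p}{2}$, then $g(m)=p-1$, with the unique extremal graph $K_p$. (ii) If $\binom{p}{2}<m<\binom{p+1}{2}$, say $m=\binom{p}{2}+r$ with $0<r<p$, then $g(m)=\max\{p-1,\,2m/(p+1)\}$, and it is attained by precisely the following graphs $G$ with $m$ edges: (a) any $G$ with $K_p\subset G$, if $0<r<\frac{p-1}{2}$; (b) any $G$ with $|V(G)|=p+1$, if $\frac{p-1}{2}<r<p$; (c) both types (a) and (b), if $r=\frac{p-1}{2}$.
   Context: For a finite graph $G$, $e(G)$ is its number of edges and $\mathrm{Mad}(G)=\max\{2e(H)/|V(H)| : H\subseteq G,\ |V(H)|\geq 1\}$. Graphs are considered up to isolated vertices (i.e., without isolated vertices) when identifying extremal graphs. *)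

theory Defs
  imports Complex_Main
begin

text \<open>
  Graphs are finite and simple: a pair of a vertex set and a set of two-element
  subsets of it. Vertices may have any type.
\<close>

type_synonym 'a ugraph = "'a set \<times> 'a set set"

abbreviation verts :: "'a ugraph \<Rightarrow> 'a set" where
  "verts G \<equiv> fst G"

abbreviation edges :: "'a ugraph \<Rightarrow> 'a set set" where
  "edges G \<equiv> snd G"

definition fin_graph :: "'a ugraph \<Rightarrow> bool" where
  "fin_graph G \<longleftrightarrow> finite (verts G) \<and> (\<forall>e \<in> edges G. e \<subseteq> verts G \<and> card e = 2)"

definition num_edges :: "'a ugraph \<Rightarrow> nat" where
  "num_edges G = card (edges G)"

definition no_isolated :: "'a ugraph \<Rightarrow> bool" where
  "no_isolated G \<longleftrightarrow> (\<forall>v \<in> verts G. \<exists>e \<in> edges G. v \<in> e)"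

definition subgraph :: "'a ugraph \<Rightarrow> 'a ugraph \<Rightarrow> bool" where
  "subgraph H G \<longleftrightarrow> fin_graph H \<and> fin_graph G \<and> verts H \<subseteq> verts G \<and> edges H \<subseteq> edges G"

definition graph_iso :: "'a ugraph \<Rightarrow> 'b ugraph \<Rightarrow> bool" where
  "graph_iso G H \<longleftrightarrow> (\<exists>f. bij_betw f (verts G) (verts H) \<and> edges H = (\<lambda>e. f ` e) ` edges G)"

definition complete_graph :: "nat \<Rightarrow> nat ugraph" where
  "complete_graph p = ({..<p}, {e. e \<subseteq> {..<p} \<and> card e = 2})"

definition contains_complete :: "nat \<Rightarrow> 'a ugraph \<Rightarrow> bool" where
  "contains_complete p G \<longleftrightarrow> (\<exists>H. subgraph H G \<and> graph_iso H (complete_graph p))"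

definition mad :: "'a ugraph \<Rightarrow> real" where
  "mad G = Max {2 * real (num_edges H) / real (card (verts H)) | H.
                  subgraph H G \<and> card (verts H) \<ge> 1}"

text \<open>
  It suffices to let the maximum range over graphs on natural numbers, since every
  finite graph is isomorphic to one of those; lemma \<open>mad_le_max_mad\<close> below
  confirms this. As \<open>Max\<close> is only meaningful on finite nonempty sets, this is also
  established below for the sets used here.
\<close>

definition max_mad :: "nat \<Rightarrow> real" where
  "max_mad m = Max {mad G | G :: nat ugraph. fin_graph G \<and> num_edges G = m}"

lemma finite_edges: "fin_graph G \<Longrightarrow> finite (edges G)"
  unfolding fin_graph_def by (metis Pow_iff finite_Pow_iff finite_subset subsetI)

lemma finite_mad_set:
  assumes "fin_graph G"
  shows "finite {2 * real (num_edges H) / real (card (verts H)) | H.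
                  subgraph H G \<and> card (verts H) \<ge> 1}" (is "finite ?S")
proof -
  have "?S \<subseteq> (\<lambda>H. 2 * real (num_edges H) / real (card (verts H))) `
              (Pow (verts G) \<times> Pow (edges G))"
    by (force simp: subgraph_def)
  moreover have "finite (Pow (verts G) \<times> Pow (edges G))"
    using assms finite_edges[OF assms] by (simp add: fin_graph_def)
  ultimately show ?thesis
    by (meson finite_imageI finite_subset)
qed

lemma mad_set_nonempty:
  assumes "fin_graph G" "verts G \<noteq> {}"
  shows "{2 * real (num_edges H) / real (card (verts H)) | H.
                  subgraph H G \<and> card (verts H) \<ge> 1} \<noteq> {}"
proof -
  have "subgraph G G \<and> card (verts G) \<ge> 1"
    using assms by (simp add: subgraph_def fin_graph_def Suc_le_eq card_gt_0_iff)
  then show ?thesis by blast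
qed

lemma mad_ge:
  assumes "subgraph H G" "card (verts H) \<ge> 1"
  shows "2 * real (num_edges H) / real (card (verts H)) \<le> mad G"
proof -
  have "fin_graph G" using assms(1) by (simp add: subgraph_def)
  then show ?thesis
    unfolding mad_def using assms by (intro Max_ge[OF finite_mad_set]) blast+
qed

lemma mad_attained:
  assumes "fin_graph G" "verts G \<noteq> {}"
  obtains H where "subgraph H G" "card (verts H) \<ge> 1"
    "mad G = 2 * real (num_edges H) / real (card (verts H))"
  using Max_in[OF finite_mad_set[OF assms(1)] mad_set_nonempty[OF assms]]
  unfolding mad_def by blast

lemma finite_max_mad_set:
  assumes "m \<ge> 1"
  shows "finite {mad G | G :: nat ugraph. fin_graph G \<and> num_edges G = m}" (is "finite ?S")
proof -
  have "?S \<subseteq> (\<lambda>(e, k). 2 * real e / real k) ` ({..m} \<times> {..2 * m})"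
  proof
    fix x assume "x \<in> ?S"
    then obtain G :: "nat ugraph" where G: "fin_graph G" "num_edges G = m" "x = mad G"
      by blast
    from G(2) assms obtain e where e: "e \<in> edges G"
      by (metis all_not_in_conv card.empty not_one_le_zero num_edges_def)
    with G(1) have e2: "e \<subseteq> verts G" "card e = 2" by (auto simp: fin_graph_def)
    then have ne: "verts G \<noteq> {}" by auto
    have "finite e" using e2(2) by (metis card.infinite zero_neq_numeral)
    then have "subgraph (e, {e}) G"
      using G(1) e e2 by (auto simp: subgraph_def fin_graph_def)
    from mad_ge[OF this] have ge1: "mad G \<ge> 1"
      using e2 by (simp add: num_edges_def)
    obtain H where H: "subgraph H G" "card (verts H) \<ge> 1"
      "mad G = 2 * real (num_edges H) / real (card (verts H))"
      using mad_attained[OF G(1) ne] by blast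
    have le: "num_edges H \<le> m"
      using H(1) G(2) finite_edges[OF G(1)] unfolding num_edges_def subgraph_def
      by (metis card_mono)
    have "real (card (verts H)) \<le> 2 * real (num_edges H)"
      using ge1 H(2,3) by (simp add: field_simps)
    then have "card (verts H) \<le> 2 * m" using le by linarith
    then show "x \<in> (\<lambda>(e, k). 2 * real e / real k) ` ({..m} \<times> {..2 * m})"
      using G(3) H(3) le by (force intro!: image_eqI[of _ _ "(num_edges H, card (verts H))"])
  qed
  then show ?thesis by (rule finite_subset) simp
qed

lemma max_mad_set_nonempty:
  "{mad G | G :: nat ugraph. fin_graph G \<and> num_edges G = m} \<noteq> {}"
proof -
  let ?E = "(\<lambda>i. {0, i}) ` {1..m}"
  have "inj_on (\<lambda>i. {0::nat, i}) {1..m}"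
    by (auto simp: inj_on_def doubleton_eq_iff)
  then have "num_edges ({0..m}, ?E) = m"
    by (simp add: num_edges_def card_image)
  moreover have "fin_graph ({0..m}, ?E)"
    by (auto simp: fin_graph_def card_insert_if)
  ultimately show ?thesis by blast
qed

lemma graph_iso_subgraph:
  fixes f :: "'a \<Rightarrow> 'b"
  assumes "inj_on f (verts G)" "subgraph H G"
  defines "F \<equiv> \<lambda>K. (f ` verts K, (\<lambda>e. f ` e) ` edges K)"
  shows "subgraph (F H) (F G)" "num_edges (F H) = num_edges H"
    "card (verts (F H)) = card (verts H)"
proof -
  have *: "fin_graph (F K)" if "fin_graph K" "verts K \<subseteq> verts G" for K
    using that assms(1) unfolding fin_graph_def F_def
    by (auto intro!: image_mono)
       (metis card_image inj_on_subset subset_trans)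
  show "subgraph (F H) (F G)"
    using *[of H] *[of G] assms(2) unfolding subgraph_def by (auto simp: F_def)
  have "edges H \<subseteq> Pow (verts G)"
    using assms(2) by (auto simp: subgraph_def fin_graph_def)
  then have "inj_on (\<lambda>e. f ` e) (edges H)"
    using assms(1) by (meson inj_on_image_Pow inj_on_subset)
  then show "num_edges (F H) = num_edges H"
    by (simp add: num_edges_def F_def card_image)
  show "card (verts (F H)) = card (verts H)"
    using assms(1,2) by (simp add: F_def subgraph_def card_image inj_on_subset)
qed

lemma mad_le_max_mad:
  fixes G :: "'a ugraph"
  assumes "fin_graph G" "num_edges G = m" "m \<ge> 1"
  shows "mad G \<le> max_mad m"
proof -
  obtain f :: "'a \<Rightarrow> nat" where f: "inj_on f (verts G)"
    using assms(1) finite_imp_inj_to_nat_seg[of "verts G"] by (auto simp: fin_graph_def)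
  let ?F = "\<lambda>K. (f ` verts K, (\<lambda>e. f ` e) ` edges K)"
  have GG: "subgraph G G" using assms(1) by (simp add: subgraph_def)
  obtain e where "e \<in> edges G"
    using assms(2,3) by (metis all_not_in_conv card.empty not_one_le_zero num_edges_def)
  then have "verts G \<noteq> {}" using assms(1) by (auto simp: fin_graph_def)
  then obtain H where H: "subgraph H G" "card (verts H) \<ge> 1"
      "mad G = 2 * real (num_edges H) / real (card (verts H))"
    using mad_attained[OF assms(1)] by blast
  note FH = graph_iso_subgraph[OF f H(1)] and FG = graph_iso_subgraph[OF f GG]
  have "mad G \<le> mad (?F G)"
    using mad_ge[OF FH(1)] FH(2,3) H(2,3) by simp
  moreover have "fin_graph (?F G)" "num_edges (?F G) = m"
    using FG(1,2) assms(2) by (simp_all add: subgraph_def)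
  then have "mad (?F G) \<le> max_mad m"
    unfolding max_mad_def by (intro Max_ge[OF finite_max_mad_set[OF assms(3)]]) blast
  ultimately show ?thesis by linarith
qed

end

theory Submission
  imports Defs
begin

text \<open>
  A subgraph with \<open>k \<le> p\<close> vertices has average degree at most \<open>k - 1 \<le> p - 1\<close>, with equality
  \<open>p - 1\<close> only for \<open>K\<^sub>p\<close>. A subgraph with \<open>k \<ge> p + 1\<close> vertices has average degree at most
  \<open>2m/k \<le> 2m/(p + 1)\<close>, with equality only if \<open>k = p + 1\<close> and it has all \<open>m\<close> edges. Both bounds
  are attained by \<open>K\<^sub>p\<close> together with one more vertex joined to \<open>r\<close> vertices of \<open>K\<^sub>p\<close>. The two
  bounds compare as \<open>2r\<close> does with \<open>p - 1\<close>, and case (i) is \<open>r = 0\<close>.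
\<close>

section \<open>Counting pairs and edges\<close>

text \<open>Doubled and over the reals, so that edge counts become quadratics comparable with
  densities, free of truncated subtraction and integer division.\<close>

lemma real_choose_two: "2 * real (n choose 2) = real n * (real n - 1)"
proof (induction n)
  case (Suc n)
  have "Suc n choose 2 = n + (n choose 2)"
    by (simp add: numeral_2_eq_2)
  then show ?case using Suc by (simp add: algebra_simps)
qed simp

lemma edges_subset_pairs: "fin_graph G \<Longrightarrow> edges G \<subseteq> {e. e \<subseteq> verts G \<and> card e = 2}"
  by (auto simp: fin_graph_def)

lemma card_pairs: "finite V \<Longrightarrow> card {e. e \<subseteq> V \<and> card e = 2} = card V choose 2"
  by (rule n_subsets)

lemma num_edges_le_choose:
  assumes "fin_graph G"
  shows "num_edges G \<le> card (verts G) choose 2"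
proof -
  have "finite (verts G)" using assms by (simp add: fin_graph_def)
  then have "num_edges G \<le> card {e. e \<subseteq> verts G \<and> card e = 2}"
    unfolding num_edges_def using edges_subset_pairs[OF assms] by (intro card_mono) auto
  then show ?thesis using \<open>finite (verts G)\<close> by (simp add: card_pairs)
qed

section \<open>Recognising complete graphs by their counts\<close>

lemma complete_graph_fin: "fin_graph (complete_graph p)"
  by (simp add: fin_graph_def complete_graph_def)

lemma num_edges_complete: "num_edges (complete_graph p) = p choose 2"
  by (simp add: num_edges_def complete_graph_def card_pairs)

lemma card_verts_complete: "card (verts (complete_graph p)) = p"
  by (simp add: complete_graph_def)

lemma graph_iso_card:
  assumes "fin_graph G" "graph_iso G H"
  shows "card (verts G) = card (verts H)" "num_edges G = num_edges H"
proof -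
  obtain f where f: "bij_betw f (verts G) (verts H)" "edges H = (\<lambda>e. f ` e) ` edges G"
    using assms(2) unfolding graph_iso_def by blast
  show "card (verts G) = card (verts H)" using f(1) by (rule bij_betw_same_card)
  \<comment> \<open>Taking images under \<open>f\<close> is injective on subsets of
    \<open>verts G\<close>, hence on edges.\<close>
  have "edges G \<subseteq> Pow (verts G)" using assms(1) by (auto simp: fin_graph_def)
  then have "inj_on (\<lambda>e. f ` e) (edges G)"
    using f(1) by (meson bij_betw_imp_inj_on inj_on_image_Pow inj_on_subset)
  then show "num_edges G = num_edges H"
    by (simp add: num_edges_def f(2) card_image)
qed

text \<open>With p choose 2 edges on p vertices every pair is an edge, so any bijection onto
  \<open>{..<p}\<close> is an isomorphism. Being complete thus becomes a purely numerical
  condition.\<close>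

lemma graph_iso_complete_iff:
  assumes G: "fin_graph G"
  shows "graph_iso G (complete_graph p) \<longleftrightarrow> card (verts G) = p \<and> num_edges G = p choose 2"
    (is "?L \<longleftrightarrow> ?R")
proof
  assume ?L
  from graph_iso_card[OF G this] show ?R
    by (simp add: card_verts_complete num_edges_complete)
next
  assume R: ?R
  have fin: "finite (verts G)" using G by (simp add: fin_graph_def)
  then obtain f where f: "bij_betw f (verts G) {..<p}"
    using R bij_betw_iff_card[of "verts G" "{..<p}"] by auto
  then have inj: "inj_on f (verts G)" and im: "f ` verts G = {..<p}"
    by (auto simp: bij_betw_def)
  let ?F = "(f ` verts G, (\<lambda>e. f ` e) ` edges G)"
  have "subgraph G G" using G by (simp add: subgraph_def)
  note F = graph_iso_subgraph[OF inj this]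
  have "fin_graph ?F" using F(1) by (simp add: subgraph_def)
  then have sub: "(\<lambda>e. f ` e) ` edges G \<subseteq> {e. e \<subseteq> {..<p} \<and> card e = 2}"
    using edges_subset_pairs[of ?F] im by simp
  have "(\<lambda>e. f ` e) ` edges G = {e. e \<subseteq> {..<p} \<and> card e = 2}"
    using sub F(2) R by (intro card_subset_eq) (simp_all add: card_pairs num_edges_def)
  then show ?L
    using f unfolding graph_iso_def complete_graph_def by (intro exI[of _ f]) simp
qed

lemma contains_complete_iff:
  "contains_complete p G \<longleftrightarrow>
     (\<exists>H. subgraph H G \<and> card (verts H) = p \<and> num_edges H = p choose 2)"
  unfolding contains_complete_def by (metis graph_iso_complete_iff subgraph_def)

lemma subgraph_num_edges_le:
  assumes "subgraph H G"
  shows "num_edges H \<le> num_edges G"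
  using assms finite_edges[of G] unfolding subgraph_def num_edges_def by (metis card_mono)

text \<open>By finiteness the edge sets coincide, and each vertex of \<open>G\<close> lies on an
  edge, hence in \<open>H\<close>. This transfers what is known of an extremal subgraph to
  \<open>G\<close> itself.\<close>

lemma subgraph_verts_eq:
  assumes "subgraph H G" "num_edges H = num_edges G" "no_isolated G"
  shows "verts H = verts G"
proof -
  have eq: "edges H = edges G"
    using assms(1,2) finite_edges[of G] unfolding subgraph_def num_edges_def
    by (metis card_subset_eq)
  have "v \<in> verts H" if v: "v \<in> verts G" for v
  proof -
    obtain e where "e \<in> edges H" "v \<in> e"
      using v assms(3) eq unfolding no_isolated_def by auto
    moreover have "fin_graph H" using assms(1) by (simp add: subgraph_def)
    ultimately show ?thesis unfolding fin_graph_def by blast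
  qed
  moreover have "verts H \<subseteq> verts G" using assms(1) by (simp add: subgraph_def)
  ultimately show ?thesis by blast
qed

section \<open>The upper bound and its equality cases\<close>

text \<open>The claimed value of g(m) for m = (p choose 2) + r with 0 \<le> r < p, covering (i) and
  (ii) together.\<close>

definition mad_bound :: "nat \<Rightarrow> nat \<Rightarrow> real" where
  "mad_bound p m = max (real p - 1) (2 * real m / (real p + 1))"

text \<open>The equality clause records both the shape of \<open>H\<close> and which term of the
  maximum is attained; the latter later separates (a), (b) and (c).\<close>

lemma subgraph_density_le:
  assumes H: "subgraph H G" "card (verts H) \<ge> 1" and p: "p \<ge> 2" and m: "num_edges G = m" "m \<ge> 1"
  defines "k \<equiv> card (verts H)" and "h \<equiv> num_edges H"
  shows "2 * real h / real k \<le> mad_bound p m"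
    and "2 * real h / real k = mad_bound p m \<Longrightarrow>
      (k = p \<and> h = p choose 2 \<and> mad_bound p m = real p - 1) \<or>
      (k = p + 1 \<and> h = m \<and> mad_bound p m = 2 * real m / (real p + 1))"
proof -
  have k1: "k \<ge> 1" using H(2) by (simp add: k_def)
  have "h \<le> k choose 2"
    using num_edges_le_choose[of H] H(1) by (simp add: subgraph_def k_def h_def)
  then have hk: "2 * real h \<le> real k * (real k - 1)"
    by (metis real_choose_two mult_le_cancel_left_pos of_nat_le_iff zero_less_numeral)
  have hm: "h \<le> m" using subgraph_num_edges_le[OF H(1)] m by (simp add: h_def)
  have bound: "real p - 1 \<le> mad_bound p m" "2 * real m / (real p + 1) \<le> mad_bound p m"
    by (simp_all add: mad_bound_def)
  have *: "2 * real h / real k \<le> mad_bound p m \<and>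
    (2 * real h / real k = mad_bound p m \<longrightarrow>
      (k = p \<and> h = p choose 2 \<and> mad_bound p m = real p - 1) \<or>
      (k = p + 1 \<and> h = m \<and> mad_bound p m = 2 * real m / (real p + 1)))"
  proof (cases "k \<le> p")
    case True
    have le: "2 * real h / real k \<le> real k - 1"
      using hk k1 by (simp add: field_simps)
    have "k = p \<and> h = p choose 2 \<and> mad_bound p m = real p - 1"
      if eq: "2 * real h / real k = mad_bound p m"
    proof -
      \<comment> \<open>The chain p - 1 \<le> \<open>mad_bound p m\<close> = 2h/k \<le> k - 1 \<le>
        p - 1 collapses.\<close>
      have kp: "k = p" using True le bound(1) eq by linarith
      have "mad_bound p m = real p - 1" using le bound(1) eq kp by linarith
      moreover have "h = p choose 2"
      proof -
        have "2 * real h = real p * (real p - 1)"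
          using eq kp p \<open>mad_bound p m = real p - 1\<close> by (simp add: field_simps)
        then show ?thesis using real_choose_two[of p] by linarith
      qed
      ultimately show ?thesis using kp by blast
    qed
    moreover have "2 * real h / real k \<le> mad_bound p m"
      using True le bound(1) by linarith
    ultimately show ?thesis by blast
  next
    case False
    have le: "2 * real h / real k \<le> 2 * real m / real k"
      using hm k1 by (simp add: divide_right_mono)
    show ?thesis
    proof (cases "k = p + 1")
      case True
      have "h = m" if "2 * real h / real k = 2 * real m / real k"
        using that k1 by simp
      then show ?thesis using le bound(2) True by (auto simp: add.commute)
    next
      case neq: False
      \<comment> \<open>Here k \<ge> p + 2, and m > 0 makes the inequality strict, so equality
        cannot occur.\<close>
      have "2 * real m / real k < 2 * real m / (real p + 1)"
        using m(2) False neq by (intro divide_strict_left_mono) auto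
      then show ?thesis using le bound(2) by linarith
    qed
  qed
  show "2 * real h / real k \<le> mad_bound p m" using * by blast
  show "(k = p \<and> h = p choose 2 \<and> mad_bound p m = real p - 1) \<or>
      (k = p + 1 \<and> h = m \<and> mad_bound p m = 2 * real m / (real p + 1))"
    if "2 * real h / real k = mad_bound p m" using * that by blast
qed

lemma verts_nonempty_if_edge:
  assumes "fin_graph G" "num_edges G \<ge> 1"
  shows "verts G \<noteq> {}"
  using num_edges_le_choose[OF assms(1)] assms(2) by (auto simp: numeral_2_eq_2)

lemma mad_le_mad_bound:
  assumes "fin_graph G" "num_edges G = m" "m \<ge> 1" "p \<ge> 2"
  shows "mad G \<le> mad_bound p m"
proof -
  have "verts G \<noteq> {}" using assms verts_nonempty_if_edge by blast
  then obtain H where "subgraph H G" "card (verts H) \<ge> 1"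
      "mad G = 2 * real (num_edges H) / real (card (verts H))"
    using mad_attained[OF assms(1)] by blast
  then show ?thesis using subgraph_density_le(1) assms by metis
qed

section \<open>Lower bounds and the extremal value\<close>

lemma mad_ge_if_contains_complete:
  assumes "contains_complete p G" "p \<ge> 2"
  shows "mad G \<ge> real p - 1"
proof -
  obtain H where H: "subgraph H G" "card (verts H) = p" "num_edges H = p choose 2"
    using assms(1) by (auto simp: contains_complete_iff)
  have "2 * real (num_edges H) / real (card (verts H)) = real p - 1"
    using assms(2) by (simp add: H(2,3) real_choose_two)
  then show ?thesis using mad_ge[OF H(1)] H(2) assms(2) by simp
qed

lemma mad_ge_average_degree:
  assumes "fin_graph G" "card (verts G) \<ge> 1"
  shows "mad G \<ge> 2 * real (num_edges G) / real (card (verts G))"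
  using assms by (intro mad_ge) (simp_all add: subgraph_def)

text \<open>A densest subgraph has one of the two shapes in \<open>subgraph_density_le\<close>;
  conversely each shape yields the matching term as a lower bound. Pairing each shape with its term
  postpones the comparison of the terms.\<close>

lemma mad_eq_mad_bound_iff:
  assumes G: "fin_graph G" "num_edges G = m" "no_isolated G" and m: "m \<ge> 1" and p: "p \<ge> 2"
  shows "mad G = mad_bound p m \<longleftrightarrow>
     (contains_complete p G \<and> mad_bound p m = real p - 1) \<or>
     (card (verts G) = p + 1 \<and> mad_bound p m = 2 * real m / (real p + 1))" (is "?L \<longleftrightarrow> ?R")
proof
  assume L: ?L
  have "verts G \<noteq> {}" using G m verts_nonempty_if_edge by blast
  then obtain H where H: "subgraph H G" "card (verts H) \<ge> 1"
      "mad G = 2 * real (num_edges H) / real (card (verts H))"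
    using mad_attained[OF G(1)] by blast
  from subgraph_density_le(2)[OF H(1,2) p G(2) m] H(3) L
  consider "card (verts H) = p" "num_edges H = p choose 2" "mad_bound p m = real p - 1"
    | "card (verts H) = p + 1" "num_edges H = m" "mad_bound p m = 2 * real m / (real p + 1)"
    by auto
  then show ?R
  proof cases
    case 1
    then show ?thesis using H(1) contains_complete_iff by blast
  next
    case 2
    \<comment> \<open>\<open>H\<close> has all m edges, so its p + 1 vertices are those of
      \<open>G\<close>.\<close>
    then show ?thesis using subgraph_verts_eq[OF H(1) _ G(3)] G(2) by simp
  qed
next
  assume ?R
  then have "mad G \<ge> mad_bound p m"
    using mad_ge_if_contains_complete[of p G] p mad_ge_average_degree[OF G(1)] G(2)
    by (auto simp: add.commute)
  then show ?L using mad_le_mad_bound[OF G(1,2) m p] by simp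
qed

lemma max_mad_eq_mad_bound:
  assumes p: "p \<ge> 2" and r: "r < p" and m: "m = (p choose 2) + r"
  shows "max_mad m = mad_bound p m"
proof -
  have "p choose 2 > 0" using p by (simp add: zero_less_binomial)
  then have m1: "m \<ge> 1" using m by linarith
  \<comment> \<open>\<open>?S\<close> joins the new vertex p to the r vertices below r;
    \<open>r < p\<close> keeps these in K_p. For r = 0 the vertex p is isolated, which
    \<open>max_mad\<close> permits.\<close>
  let ?K = "{e. e \<subseteq> {..<p} \<and> card e = 2}" and ?S = "(\<lambda>i. {i, p}) ` {..<r}"
  let ?G = "({..p}, ?K \<union> ?S)"
  have fin: "fin_graph ?G"
    using r by (auto simp: fin_graph_def card_insert_if)
  have "inj_on (\<lambda>i. {i, p}) {..<r}"
    using r by (auto simp: inj_on_def doubleton_eq_iff)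
  then have "card ?S = r" by (simp add: card_image)
  moreover have "?K \<inter> ?S = {}" by auto
  ultimately have num: "num_edges ?G = m"
    by (simp add: num_edges_def card_Un_disjoint card_pairs m)
  have "subgraph (complete_graph p) ?G"
    using fin complete_graph_fin by (auto simp: subgraph_def complete_graph_def)
  then have "contains_complete p ?G"
    using contains_complete_iff card_verts_complete num_edges_complete by blast
  then have "mad ?G \<ge> real p - 1" using mad_ge_if_contains_complete p by blast
  moreover have "mad ?G \<ge> 2 * real m / (real p + 1)"
    using mad_ge_average_degree[OF fin] num by (simp add: add.commute)
  ultimately have "mad ?G \<ge> mad_bound p m" by (simp add: mad_bound_def)
  then have "mad_bound p m \<le> max_mad m" using mad_le_max_mad[OF fin num m1] by linarith
  moreover have "max_mad m \<le> mad_bound p m"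
    unfolding max_mad_def using mad_le_mad_bound m1 p
    by (intro Max.boundedI[OF finite_max_mad_set[OF m1] max_mad_set_nonempty]) blast
  ultimately show ?thesis by simp
qed

section \<open>Comparing the two terms and assembling the cases\<close>

theorem theorem3p1:
  fixes p m :: nat
  assumes "p \<ge> 2"
  shows
    "(m = p choose 2 \<longrightarrow>
        max_mad m = real p - 1 \<and>
        (\<forall>G :: 'a ugraph. fin_graph G \<and> no_isolated G \<and> num_edges G = m \<longrightarrow>
           (mad G = max_mad m \<longleftrightarrow> graph_iso G (complete_graph p)))) \<and>
     (p choose 2 < m \<and> m < (p + 1) choose 2 \<longrightarrow>
        (\<exists>r. 0 < r \<and> r < p \<and> m = (p choose 2) + r \<and>
           max_mad m = max (real p - 1) (2 * real m / (real p + 1)) \<and>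
           (\<forall>G :: 'a ugraph. fin_graph G \<and> no_isolated G \<and> num_edges G = m \<longrightarrow>
              (real r < (real p - 1) / 2 \<longrightarrow>
                 (mad G = max_mad m \<longleftrightarrow> contains_complete p G)) \<and>
              (real r > (real p - 1) / 2 \<longrightarrow>
                 (mad G = max_mad m \<longleftrightarrow> card (verts G) = p + 1)) \<and>
              (real r = (real p - 1) / 2 \<longrightarrow>
                 (mad G = max_mad m \<longleftrightarrow>
                    contains_complete p G \<or> card (verts G) = p + 1)))))"
proof -
  have pos: "p choose 2 > 0" using assms by (simp add: zero_less_binomial)
  \<comment> \<open>The numerator is p(p - 1) + 2r - (p - 1)(p + 1), so the sign of 2r - (p - 1)
    decides which term is larger.\<close>
  have diff: "2 * real m / (real p + 1) - (real p - 1) = (2 * real r - (real p - 1)) / (real p + 1)"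
    if "m = (p choose 2) + r" for r
  proof -
    have "2 * real m = real p * (real p - 1) + 2 * real r"
      using real_choose_two[of p] that by simp
    then show ?thesis by (simp add: field_simps)
  qed
  have lt: "2 * real m / (real p + 1) < real p - 1"
    if "m = (p choose 2) + r" "real r < (real p - 1) / 2" for r
  proof -
    have "(2 * real r - (real p - 1)) / (real p + 1) < 0"
      using that(2) by (simp add: divide_neg_pos)
    then show ?thesis using diff[OF that(1)] by linarith
  qed
  have gt: "2 * real m / (real p + 1) > real p - 1"
    if "m = (p choose 2) + r" "real r > (real p - 1) / 2" for r
  proof -
    have "(2 * real r - (real p - 1)) / (real p + 1) > 0"
      using that(2) by simp
    then show ?thesis using diff[OF that(1)] by linarith
  qed
  have eq: "2 * real m / (real p + 1) = real p - 1"
    if "m = (p choose 2) + r" "real r = (real p - 1) / 2" for r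
  proof -
    have "2 * real r - (real p - 1) = 0" using that(2) by simp
    then show ?thesis using diff[OF that(1)] by simp
  qed
  show ?thesis
  proof (intro conjI impI)
    assume m: "m = p choose 2"
    \<comment> \<open>This is r = 0, where 0 < (p - 1)/2 since p \<ge> 2; only the K_p alternative
      survives.\<close>
    have less: "2 * real m / (real p + 1) < real p - 1"
      using lt[of 0] m assms by simp
    then have bound: "mad_bound p m = real p - 1" by (simp add: mad_bound_def)
    have max: "max_mad m = mad_bound p m"
      using max_mad_eq_mad_bound[of p 0] m assms by simp
    show "max_mad m = real p - 1" using max bound by simp
    show "\<forall>G :: 'a ugraph. fin_graph G \<and> no_isolated G \<and> num_edges G = m \<longrightarrow>
           (mad G = max_mad m \<longleftrightarrow> graph_iso G (complete_graph p))"
    proof (intro allI impI, elim conjE)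
      fix G :: "'a ugraph"
      assume G: "fin_graph G" "no_isolated G" "num_edges G = m"
      have "mad G = max_mad m \<longleftrightarrow> contains_complete p G"
        using mad_eq_mad_bound_iff[OF G(1,3,2) _ assms] max bound less m pos by auto
      also have "\<dots> \<longleftrightarrow> graph_iso G (complete_graph p)"
      proof
        assume "contains_complete p G"
        then obtain H where "subgraph H G" "card (verts H) = p" "num_edges H = p choose 2"
          by (auto simp: contains_complete_iff)
        \<comment> \<open>The copy of K_p already uses all m edges, so it spans
          \<open>G\<close>.\<close>
        then show "graph_iso G (complete_graph p)"
          using subgraph_verts_eq[of H G] G m by (simp add: graph_iso_complete_iff)
      next
        assume "graph_iso G (complete_graph p)"
        then show "contains_complete p G"
          using G(1) unfolding contains_complete_def subgraph_def by blast
      qed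
      finally show "mad G = max_mad m \<longleftrightarrow> graph_iso G (complete_graph p)" .
    qed
  next
    assume range: "p choose 2 < m \<and> m < (p + 1) choose 2"
    define r where "r = m - (p choose 2)"
    have m: "m = (p choose 2) + r" and r0: "0 < r" using range by (simp_all add: r_def)
    \<comment> \<open>Pascal's rule: consecutive values differ by p, whence r < p.\<close>
    have "(p + 1) choose 2 = p + (p choose 2)" by (simp add: numeral_2_eq_2)
    then have rp: "r < p" using range m by simp
    have max: "max_mad m = mad_bound p m" using max_mad_eq_mad_bound[OF assms rp m] .
    have m1: "m \<ge> 1" using range by simp
    have char: "(real r < (real p - 1) / 2 \<longrightarrow>
                 (mad G = max_mad m \<longleftrightarrow> contains_complete p G)) \<and>
              (real r > (real p - 1) / 2 \<longrightarrow>
                 (mad G = max_mad m \<longleftrightarrow> card (verts G) = p + 1)) \<and>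
              (real r = (real p - 1) / 2 \<longrightarrow>
                 (mad G = max_mad m \<longleftrightarrow>
                    contains_complete p G \<or> card (verts G) = p + 1))"
      if G: "fin_graph G \<and> no_isolated G \<and> num_edges G = m" for G :: "'a ugraph"
    proof -
      have iff: "mad G = max_mad m \<longleftrightarrow>
          (contains_complete p G \<and> mad_bound p m = real p - 1) \<or>
          (card (verts G) = p + 1 \<and> mad_bound p m = 2 * real m / (real p + 1))"
        using mad_eq_mad_bound_iff[of G m p] G m1 assms max by simp
      \<comment> \<open>A strict comparison falsifies the side condition of one disjunct of
        \<open>iff\<close>; a tie keeps both.\<close>
      have "mad G = max_mad m \<longleftrightarrow> contains_complete p G" if "real r < (real p - 1) / 2"
        unfolding iff using lt[OF m that] by (auto simp: mad_bound_def)
      moreover have "mad G = max_mad m \<longleftrightarrow> card (verts G) = p + 1"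
        if "real r > (real p - 1) / 2"
        unfolding iff using gt[OF m that] by (auto simp: mad_bound_def)
      moreover have "mad G = max_mad m \<longleftrightarrow> contains_complete p G \<or> card (verts G) = p + 1"
        if "real r = (real p - 1) / 2"
        unfolding iff using eq[OF m that] by (auto simp: mad_bound_def)
      ultimately show ?thesis by blast
    qed
    have max_val: "max_mad m = max (real p - 1) (2 * real m / (real p + 1))"
      using max by (simp add: mad_bound_def)
    show "\<exists>r. 0 < r \<and> r < p \<and> m = (p choose 2) + r \<and>
           max_mad m = max (real p - 1) (2 * real m / (real p + 1)) \<and>
           (\<forall>G :: 'a ugraph. fin_graph G \<and> no_isolated G \<and> num_edges G = m \<longrightarrow>
              (real r < (real p - 1) / 2 \<longrightarrow>
                 (mad G = max_mad m \<longleftrightarrow> contains_complete p G)) \<and>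
              (real r > (real p - 1) / 2 \<longrightarrow>
                 (mad G = max_mad m \<longleftrightarrow> card (verts G) = p + 1)) \<and>
              (real r = (real p - 1) / 2 \<longrightarrow>
                 (mad G = max_mad m \<longleftrightarrow>
                    contains_complete p G \<or> card (verts G) = p + 1)))"
      by (rule exI[of _ r], rule conjI[OF r0], rule conjI[OF rp], rule conjI[OF m],
          rule conjI[OF max_val], intro allI impI, erule char)
  qed
qed

end
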